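(* Let $F$ be a field of characteristic $\ne2$ and let $y^2=f(x)$ be the affine equation of a hyperelliptic curve of genus $g$ over $F$, $\deg f=2g+1$. Given positive integers $\ell>g$, let $\mu:=\ell-g$ and define a homogeneous polynomial of degree $\mu$ in the variables $t_{-\mu},\dots,t_0,\dots,t_{\mu-1}$ by $$Q_{\mu,\ell+1}=\det(t_{j-i})_{0\le i,j\le\mu-1}\in\mathbb{Z}[t_{-\mu},\dots,t_0,\dots,t_{\mu-1}].$$ Then $P_{g,\ell}=Q_{\mu,\ell+1}|_{t_i=P_{\ell-1+i,\ell+i}}$.
   Context: The curve is smooth, so $f$ has no repeated roots over $\overline F$. $D^k=D^k_x$ denotes the $k$-th Hasse derivative with respect to $x$: on $F[x]$, $D^k(\sum a_ix^i)=\sum_{i\ge k}\binom ika_ix^{i-k}$, extended uniquely to $F[x,y,y^{-1}]/(y^2-f(x))$ as $F$-linear maps with $D^0=\mathrm{id}$ and $D^k(\phi\psi)=\sum_{i=0}^kD^i\phi\,D^{k-i}\psi$. For $\ell>g$, the Hasse inflection polynomial $P_{g,\ell}(x)\in F[x]$ is defined by $$\det(D^jx^iy)_{0\le i\le\ell-g-1;\ \ell+1\le j\le2\ell-g}=(f^{-(\ell+1)}y)^{\ell-g}P_{g,\ell}(x).$$ The atomic inflection polynomials $P_{m,m+1}(x)$ (for the same fixed $f$, with $m$ any integer $\ge g$) are defined by $D^{m+2}y=f^{-(m+2)}y\cdot P_{m,m+1}(x)$, which is the special case $\ell=m+1$ of the same formula with $m$ in place of $g$. *)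

theory Defs
  imports
    "HOL-Algebra.Algebraic_Closure_Type"
    "HOL-Algebra.QuotRing"
    "HOL-Combinatorics.Permutations"
    "HOL-Library.Poly_Mapping"
    "Jordan_Normal_Form.Determinant"
begin

section \<open>Hasse derivatives on the coordinate ring\<close>

text \<open>The affine curve \<open>y\<^sup>2 = f(x)\<close> is smooth: in odd degree and characteristic different from 2
  this means that \<open>f\<close> has only simple roots over an algebraic closure.\<close>

definition hyperelliptic_equation :: "nat \<Rightarrow> 'a::field poly \<Rightarrow> bool" where
  "hyperelliptic_equation g f \<longleftrightarrow>
     degree f = 2 * g + 1 \<and> rsquarefree (map_poly to_ac f)"

text \<open>The ring \<open>F[x,y,y\<^sup>-\<^sup>1]/(y\<^sup>2 - f)\<close> is presented as the quotient of \<open>F[x][Y][Z]\<close> by the ideal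
  generated by \<open>Y\<^sup>2 - f\<close> and \<open>Y Z - 1\<close>. In the type \<^typ>\<open>'a poly poly poly\<close> the outermost
  variable is \<open>Z\<close>, the middle one is \<open>Y\<close> and the innermost one is \<open>x\<close>.\<close>

abbreviation polyring :: "'a::field poly poly poly ring" where
  "polyring \<equiv> ring_of_type_algebra"

definition var_Y :: "'a::field poly poly poly" where
  "var_Y = [:[:0, 1:]:]"

definition var_Z :: "'a::field poly poly poly" where
  "var_Z = [:0, 1:]"

definition curve_ideal :: "'a::field poly \<Rightarrow> 'a poly poly poly set" where
  "curve_ideal f = Idl\<^bsub>polyring\<^esub> {var_Y ^ 2 - [:[:f:]:], var_Y * var_Z - 1}"

definition curve_ring :: "'a::field poly \<Rightarrow> 'a poly poly poly set ring" where
  "curve_ring f = polyring Quot curve_ideal f"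

definition curve_y :: "'a::field poly \<Rightarrow> 'a poly poly poly set" where
  "curve_y f = curve_ideal f +>\<^bsub>polyring\<^esub> var_Y"

text \<open>The canonical map from \<open>F[x]\<close> to the coordinate ring.\<close>

definition curve_of_poly :: "'a::field poly \<Rightarrow> 'a poly \<Rightarrow> 'a poly poly poly set" where
  "curve_of_poly f p = curve_ideal f +>\<^bsub>polyring\<^esub> [:[:p:]:]"

definition hasse_deriv_poly :: "nat \<Rightarrow> 'a::field poly \<Rightarrow> 'a poly" where
  "hasse_deriv_poly k p = (\<Sum>i = k..degree p. monom (of_nat (i choose k) * coeff p i) (i - k))"

definition is_hasse_extension ::
    "'a::field poly \<Rightarrow> (nat \<Rightarrow> 'a poly poly poly set \<Rightarrow> 'a poly poly poly set) \<Rightarrow> bool" where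
  "is_hasse_extension f D \<longleftrightarrow>
     (let R = curve_ring f in
       (\<forall>k. D k \<in> carrier R \<rightarrow>\<^sub>E carrier R) \<and>
       (\<forall>k. \<forall>\<phi>\<in>carrier R. \<forall>\<psi>\<in>carrier R. D k (\<phi> \<oplus>\<^bsub>R\<^esub> \<psi>) = D k \<phi> \<oplus>\<^bsub>R\<^esub> D k \<psi>) \<and>
       (\<forall>k c. \<forall>\<phi>\<in>carrier R.
          D k (curve_of_poly f [:c:] \<otimes>\<^bsub>R\<^esub> \<phi>) = curve_of_poly f [:c:] \<otimes>\<^bsub>R\<^esub> D k \<phi>) \<and>
       (\<forall>k p. D k (curve_of_poly f p) = curve_of_poly f (hasse_deriv_poly k p)) \<and>
       (\<forall>\<phi>\<in>carrier R. D 0 \<phi> = \<phi>) \<and>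
       (\<forall>k. \<forall>\<phi>\<in>carrier R. \<forall>\<psi>\<in>carrier R.
          D k (\<phi> \<otimes>\<^bsub>R\<^esub> \<psi>) = (\<Oplus>\<^bsub>R\<^esub>i\<in>{..k}. D i \<phi> \<otimes>\<^bsub>R\<^esub> D (k - i) \<psi>)))"

definition hasse_deriv ::
    "'a::field poly \<Rightarrow> nat \<Rightarrow> 'a poly poly poly set \<Rightarrow> 'a poly poly poly set" where
  "hasse_deriv f = (THE D. is_hasse_extension f D)"

section \<open>Inflection polynomials\<close>

text \<open>Leibniz formula for the determinant of \<open>(A i j)\<^sub>0\<^sub>\<le>\<^sub>i\<^sub>,\<^sub>j\<^sub><\<^sub>n\<close> over a ring given by a record; the
  constant \<^const>\<open>det\<close> is only available for type class rings.\<close>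

definition ring_det :: "('b, 'c) ring_scheme \<Rightarrow> nat \<Rightarrow> (nat \<Rightarrow> nat \<Rightarrow> 'b) \<Rightarrow> 'b" where
  "ring_det R n A =
     (\<Oplus>\<^bsub>R\<^esub>\<pi>\<in>{\<pi>. \<pi> permutes {0..<n}}.
        (if evenperm \<pi> then \<one>\<^bsub>R\<^esub> else \<ominus>\<^bsub>R\<^esub> \<one>\<^bsub>R\<^esub>) \<otimes>\<^bsub>R\<^esub> (\<Otimes>\<^bsub>R\<^esub>i\<in>{0..<n}. A i (\<pi> i)))"

text \<open>Column \<open>j\<close> of the matrix below, for \<open>0 \<le> j < l - g\<close>, carries the derivative of order
  \<open>l + 1 + j\<close>, so the orders run from \<open>l + 1\<close> to \<open>2l - g\<close>.
  The parameter \<open>g\<close> is not tied to the degree of \<open>f\<close>: for fixed \<open>f\<close> the atomic polynomial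
  \<open>P\<^bsub>m,m+1\<^esub>\<close> is \<open>hasse_inflection f m (m + 1)\<close>, where the determinant is the
  single entry \<open>D\<^bsup>m+2\<^esup> y\<close>.\<close>

definition hasse_inflection :: "'a::field poly \<Rightarrow> nat \<Rightarrow> nat \<Rightarrow> 'a poly" where
  "hasse_inflection f g l =
     (let R = curve_ring f; y = curve_y f in
       THE P. ring_det R (l - g)
           (\<lambda>i j. hasse_deriv f (l + 1 + j) (curve_of_poly f (monom 1 i) \<otimes>\<^bsub>R\<^esub> y)) =
         ((inv\<^bsub>R\<^esub> (curve_of_poly f f) [^]\<^bsub>R\<^esub> (l + 1)) \<otimes>\<^bsub>R\<^esub> y) [^]\<^bsub>R\<^esub> (l - g)
           \<otimes>\<^bsub>R\<^esub> curve_of_poly f P)"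

section \<open>Integer polynomials in the variables \<open>t\<^sub>i\<close>, indexed by the integers\<close>

type_synonym tpoly = "(int \<Rightarrow>\<^sub>0 nat) \<Rightarrow>\<^sub>0 int"

definition tvar :: "int \<Rightarrow> tpoly" where
  "tvar i = Poly_Mapping.single (Poly_Mapping.single i 1) 1"

definition tvars :: "tpoly \<Rightarrow> int set" where
  "tvars q = (\<Union>m\<in>Poly_Mapping.keys q. Poly_Mapping.keys m)"

definition thomogeneous :: "nat \<Rightarrow> tpoly \<Rightarrow> bool" where
  "thomogeneous d q \<longleftrightarrow>
     (\<forall>m\<in>Poly_Mapping.keys q. (\<Sum>i\<in>Poly_Mapping.keys m. Poly_Mapping.lookup m i) = d)"

definition tsubst :: "(int \<Rightarrow> 'b::comm_ring_1) \<Rightarrow> tpoly \<Rightarrow> 'b" where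
  "tsubst a q = (\<Sum>m\<in>Poly_Mapping.keys q. of_int (Poly_Mapping.lookup q m) *
     (\<Prod>i\<in>Poly_Mapping.keys m. a i ^ Poly_Mapping.lookup m i))"

text \<open>The polynomial \<open>Q\<^bsub>\<mu>,l+1\<^esub>\<close>; it depends only on \<open>\<mu>\<close>.\<close>

definition Q_poly :: "nat \<Rightarrow> tpoly" where
  "Q_poly \<mu> = det (mat \<mu> \<mu> (\<lambda>(i, j). tvar (int j - int i)))"

end

theory Submission
  imports Defs "Jordan_Normal_Form.Char_Poly"
begin

text \<open>A Hasse derivation of the coordinate ring \<open>R = F[x,y,y\<^sup>-\<^sup>1]/(y\<^sup>2 - f)\<close> is the same as a ring
  homomorphism \<open>\<phi> \<mapsto> \<Sum>\<^sub>k D\<^sup>k\<phi> t\<^sup>k\<close> from \<open>R\<close> to \<open>R[[t]]\<close>, and the one in question sends \<open>x\<close> to \<open>x + t\<close> and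
  \<open>y\<close> to the square root \<open>y (1 + (f(x + t) - f(x)) / f(x))\<^sup>1\<^sup>/\<^sup>2\<close> of \<open>f(x + t)\<close> with constant term \<open>y\<close>; it is
  unique because 2 and \<open>y\<close> are units. Hence \<open>D\<^sup>k y = y f\<^sup>-\<^sup>k P\<^sub>k\<close>, where \<open>\<Sum>\<^sub>k P\<^sub>k t\<^sup>k\<close> is a square root of
  \<open>1 + \<Sum>\<^sub>k\<^sub>>\<^sub>0 f\<^bsup>k-1\<^esup> D\<^sup>k f t\<^sup>k\<close> over \<open>F[x]\<close>; so \<open>P\<^sub>k\<close> is the paper's \<open>P\<^bsub>k-2,k-1\<^esub>\<close>.
  By the Leibniz rule the matrix \<open>(D\<^bsup>l+1+j\<^esup> x\<^sup>i y)\<close> is a unipotent matrix times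
  \<open>(D\<^bsup>l+1+j-i\<^esup> y)\<close>. Taking the powers of \<open>f\<close> out of the rows and columns of the latter leaves the
  matrix \<open>(P\<^bsub>l+1+j-i\<^esub>)\<close> times \<open>f\<^bsup>-(l+1)\<^esup> y\<close>.\<close>

section \<open>The coordinate ring\<close>

lemma ring_of_type_algebra_simps [simp]:
  "carrier ring_of_type_algebra = UNIV"
  "monoid.mult ring_of_type_algebra = (*)"
  "monoid.one ring_of_type_algebra = 1"
  "ring.zero ring_of_type_algebra = 0"
  "ring.add ring_of_type_algebra = (+)"
  by (auto simp: ring_of_type_algebra_def fun_eq_iff)

text \<open>The projection onto the quotient. Every element of the coordinate ring is written
  through a representative, so that identities in the record ring become identities between
  polynomials of type class rings.\<close>

definition curve_class :: "'a::field poly \<Rightarrow> 'a poly poly poly \<Rightarrow> 'a poly poly poly set" where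
  "curve_class f p = curve_ideal f +>\<^bsub>polyring\<^esub> p"

lemma curve_y_class: "curve_y f = curve_class f var_Y"
  by (simp add: curve_y_def curve_class_def)

lemma curve_of_poly_class: "curve_of_poly f p = curve_class f [:[:p:]:]"
  by (simp add: curve_of_poly_def curve_class_def)

lemma cring_polyring: "cring (polyring :: 'a::field poly poly poly ring)"
  by (rule cring_from_type_algebra)

lemma ideal_curve_ideal: "ideal (curve_ideal f) polyring"
  unfolding curve_ideal_def
  by (rule ring.genideal_ideal) (auto intro: ring_from_type_algebra)

lemma cring_curve_ring: "cring (curve_ring f)"
  unfolding curve_ring_def
  by (rule ideal.quotient_is_cring[OF ideal_curve_ideal cring_polyring])

lemma curve_class_hom: "ring_hom_cring polyring (curve_ring f) (curve_class f)"
  using ideal.rcos_ring_hom_cring[OF ideal_curve_ideal cring_polyring]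
  by (simp add: curve_ring_def curve_class_def[abs_def])

lemma carrier_curve_ring: "carrier (curve_ring f) = range (curve_class f)"
  by (auto simp: curve_ring_def FactRing_def A_RCOSETS_def' curve_class_def)

lemma curve_class_closed [simp]: "curve_class f p \<in> carrier (curve_ring f)"
  by (simp add: carrier_curve_ring)

lemma curve_class_add: "curve_class f p \<oplus>\<^bsub>curve_ring f\<^esub> curve_class f q = curve_class f (p + q)"
  and curve_class_mult: "curve_class f p \<otimes>\<^bsub>curve_ring f\<^esub> curve_class f q = curve_class f (p * q)"
  and curve_class_one: "\<one>\<^bsub>curve_ring f\<^esub> = curve_class f 1"
  and curve_class_zero: "\<zero>\<^bsub>curve_ring f\<^esub> = curve_class f 0"
proof -
  interpret ring_hom_cring polyring "curve_ring f" "curve_class f"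
    by (rule curve_class_hom)
  show "curve_class f p \<oplus>\<^bsub>curve_ring f\<^esub> curve_class f q = curve_class f (p + q)"
    "curve_class f p \<otimes>\<^bsub>curve_ring f\<^esub> curve_class f q = curve_class f (p * q)"
    "\<one>\<^bsub>curve_ring f\<^esub> = curve_class f 1" "\<zero>\<^bsub>curve_ring f\<^esub> = curve_class f 0"
    using hom_add[of p q] hom_mult[of p q] hom_one hom_zero by simp_all
qed

lemma curve_class_uminus: "\<ominus>\<^bsub>curve_ring f\<^esub> curve_class f p = curve_class f (- p)"
proof -
  interpret cring "curve_ring f" by (rule cring_curve_ring)
  show ?thesis
    by (rule minus_equality) (simp_all add: curve_class_add curve_class_zero)
qed

lemma curve_class_pow: "curve_class f p [^]\<^bsub>curve_ring f\<^esub> (n::nat) = curve_class f (p ^ n)"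
proof -
  interpret cring "curve_ring f" by (rule cring_curve_ring)
  show ?thesis
    by (induction n) (simp_all add: curve_class_one curve_class_mult mult.commute)
qed

lemma curve_class_finsum:
  "finite A \<Longrightarrow> (\<Oplus>\<^bsub>curve_ring f\<^esub>i\<in>A. curve_class f (h i)) = curve_class f (\<Sum>i\<in>A. h i)"
proof (induction A rule: finite_induct)
  interpret cring "curve_ring f" by (rule cring_curve_ring)
  case empty
  show ?case by (simp add: curve_class_zero)
next
  interpret cring "curve_ring f" by (rule cring_curve_ring)
  case (insert a A)
  then show ?case by (simp add: curve_class_add)
qed

lemma curve_class_finprod:
  "finite A \<Longrightarrow> (\<Otimes>\<^bsub>curve_ring f\<^esub>i\<in>A. curve_class f (h i)) = curve_class f (\<Prod>i\<in>A. h i)"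
proof (induction A rule: finite_induct)
  interpret cring "curve_ring f" by (rule cring_curve_ring)
  case empty
  show ?case by (simp add: curve_class_one)
next
  interpret cring "curve_ring f" by (rule cring_curve_ring)
  case (insert a A)
  then show ?case by (simp add: curve_class_mult)
qed

section \<open>Determinants over the coordinate ring\<close>

lemma det_mat_Leibniz:
  "det (mat n n (\<lambda>(i, j). A i j)) =
     (\<Sum>\<pi> | \<pi> permutes {0..<n}. signof \<pi> * (\<Prod>i = 0..<n. A i (\<pi> i)))"
proof -
  have "(\<Prod>i = 0..<n. mat n n (\<lambda>(i, j). A i j) $$ (i, \<pi> i)) = (\<Prod>i = 0..<n. A i (\<pi> i))"
    if "\<pi> permutes {0..<n}" for \<pi>
    using permutes_in_image[OF that] by (intro prod.cong) auto
  then show ?thesis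
    by (subst det_def'[of _ n]) auto
qed

text \<open>Both sides are Leibniz sums, and the projection respects signs, products and sums. It
  makes matrix products and triangular determinants available for the determinant over the
  curve.\<close>

lemma curve_class_det:
  "ring_det (curve_ring f) n (\<lambda>i j. curve_class f (A i j)) =
     curve_class f (det (mat n n (\<lambda>(i, j). A i j)))"
proof -
  have sgn: "(if evenperm \<pi> then \<one>\<^bsub>curve_ring f\<^esub> else \<ominus>\<^bsub>curve_ring f\<^esub> \<one>\<^bsub>curve_ring f\<^esub>) =
      curve_class f (signof \<pi>)" for \<pi> :: "nat \<Rightarrow> nat"
    by (simp add: sign_def curve_class_one curve_class_uminus)
  show ?thesis
    unfolding ring_det_def sgn det_mat_Leibniz
    by (simp add: curve_class_finprod curve_class_mult curve_class_finsum finite_permutations)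
qed

lemma curve_class_cong_add:
  "\<lbrakk>curve_class f p = curve_class f p'; curve_class f q = curve_class f q'\<rbrakk>
     \<Longrightarrow> curve_class f (p + q) = curve_class f (p' + q')"
  by (simp flip: curve_class_add)

lemma curve_class_cong_mult:
  "\<lbrakk>curve_class f p = curve_class f p'; curve_class f q = curve_class f q'\<rbrakk>
     \<Longrightarrow> curve_class f (p * q) = curve_class f (p' * q')"
  by (simp flip: curve_class_mult)

lemma curve_class_cong_diff:
  "\<lbrakk>curve_class f p = curve_class f p'; curve_class f q = curve_class f q'\<rbrakk>
     \<Longrightarrow> curve_class f (p - q) = curve_class f (p' - q')"
  using curve_class_cong_add[of f p p' "- q" "- q'"] by (simp flip: curve_class_uminus)

section \<open>Congruence modulo the curve ideal\<close>

lemma curve_class_eq_iff: "curve_class f p = curve_class f q \<longleftrightarrow> p - q \<in> curve_ideal f"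
proof -
  interpret ideal "curve_ideal f" polyring by (rule ideal_curve_ideal)
  have zero: "curve_class f r = curve_class f 0 \<longleftrightarrow> r \<in> curve_ideal f" for r
  proof -
    have "curve_class f 0 = curve_ideal f"
      using a_rcos_const[of 0] additive_subgroup.zero_closed[OF additive_subgroup_axioms]
      by (simp add: curve_class_def)
    then show ?thesis
      using a_rcos_const[of r] a_rcos_self[of r] by (metis UNIV_I curve_class_def ring_of_type_algebra_simps(1))
  qed
  have "curve_class f p = curve_class f q \<longleftrightarrow> curve_class f (p - q) = curve_class f 0"
    using curve_class_cong_diff[of f p q q q] curve_class_cong_add[of f "p - q" 0 q q]
    by (metis add_0 diff_add_cancel diff_self)
  then show ?thesis
    by (simp only: zero)
qed

lemma curve_ideal_zero: "0 \<in> curve_ideal f"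
  using curve_class_eq_iff[of f 0 0] by simp

lemma curve_ideal_add:
  "\<lbrakk>p \<in> curve_ideal f; q \<in> curve_ideal f\<rbrakk> \<Longrightarrow> p + q \<in> curve_ideal f"
  using curve_class_cong_add[of f p 0 q 0] by (simp add: curve_class_eq_iff)

lemma curve_ideal_sum:
  "(\<And>i. i \<in> A \<Longrightarrow> p i \<in> curve_ideal f) \<Longrightarrow> (\<Sum>i\<in>A. p i) \<in> curve_ideal f"
  by (induction A rule: infinite_finite_induct)
    (simp_all add: curve_ideal_zero curve_ideal_add)

lemma curve_ideal_mult: "p \<in> curve_ideal f \<Longrightarrow> q * p \<in> curve_ideal f"
  using ideal.I_l_closed[OF ideal_curve_ideal, of p f q] by simp

lemma curve_ideal_generators:
  "var_Y ^ 2 - [:[:f:]:] \<in> curve_ideal f" "var_Y * var_Z - 1 \<in> curve_ideal f"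
  using ring.genideal_self[OF ring_from_type_algebra,
      of "{var_Y ^ 2 - [:[:f:]:], var_Y * var_Z - 1}"]
  by (auto simp: curve_ideal_def)

lemma curve_class_Y_square: "curve_class f (var_Y ^ 2) = curve_class f [:[:f:]:]"
  and curve_class_Y_Z: "curve_class f (var_Y * var_Z) = curve_class f 1"
  by (simp_all add: curve_class_eq_iff curve_ideal_generators)

text \<open>Minimality of the generated ideal, with negation obtained as multiplication by -1. It is
  applied to preimages under homomorphisms, so that descent to the quotient is checked on the two
  generators.\<close>

lemma curve_ideal_subsetI:
  assumes "0 \<in> J" and add: "\<And>p q. p \<in> J \<Longrightarrow> q \<in> J \<Longrightarrow> p + q \<in> J"
    and mult: "\<And>p q. p \<in> J \<Longrightarrow> q * p \<in> J"
    and gens: "var_Y ^ 2 - [:[:f:]:] \<in> J" "var_Y * var_Z - 1 \<in> J"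
  shows "curve_ideal f \<subseteq> J"
  unfolding curve_ideal_def
proof (rule ring.genideal_minimal)
  interpret cring "polyring :: 'a poly poly poly ring" by (rule cring_polyring)
  show "ring (polyring :: 'a poly poly poly ring)" by (rule ring_axioms)
  show "ideal J polyring"
  proof (rule idealI)
    show "ring (polyring :: 'a poly poly poly ring)" by (rule ring_axioms)
    show "subgroup J (add_monoid polyring)"
    proof (rule add.subgroupI)
      fix p assume p: "p \<in> J"
      have "\<ominus>\<^bsub>polyring\<^esub> p = - p"
        using minus_equality[of "- p" p] by simp
      then show "\<ominus>\<^bsub>polyring\<^esub> p \<in> J"
        using mult[OF p, of "-1"] by simp
    next
      fix p q assume "p \<in> J" "q \<in> J"
      then show "p \<oplus>\<^bsub>polyring\<^esub> q \<in> J" by (simp add: add)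
    qed (use \<open>0 \<in> J\<close> in auto)
    show "x \<otimes>\<^bsub>polyring\<^esub> a \<in> J" "a \<otimes>\<^bsub>polyring\<^esub> x \<in> J" if "a \<in> J" for a x
      using mult[OF that, of x] by (simp_all add: mult.commute)
  qed
qed (use gens in auto)

text \<open>The kernel of coefficientwise reduction to power series over the coordinate ring R: a
  difference \<open>A - B\<close> lies in it iff \<open>A\<close> and \<open>B\<close> represent the
  same element of R[[t]].\<close>

definition curve_fps_ideal :: "'a::field poly \<Rightarrow> 'a poly poly poly fps set" where
  "curve_fps_ideal f = {A. \<forall>k. fps_nth A k \<in> curve_ideal f}"

lemma curve_fps_ideal_add:
  "\<lbrakk>A \<in> curve_fps_ideal f; B \<in> curve_fps_ideal f\<rbrakk> \<Longrightarrow> A + B \<in> curve_fps_ideal f"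
  by (simp add: curve_fps_ideal_def curve_ideal_add)

lemma curve_fps_ideal_mult:
  "B \<in> curve_fps_ideal f \<Longrightarrow> A * B \<in> curve_fps_ideal f"
  by (auto simp: curve_fps_ideal_def fps_mult_nth intro!: curve_ideal_sum curve_ideal_mult)

lemma curve_fps_ideal_const:
  "p \<in> curve_ideal f \<Longrightarrow> fps_const p \<in> curve_fps_ideal f"
  by (simp add: curve_fps_ideal_def curve_ideal_zero)

lemma curve_ideal_diff:
  "\<lbrakk>p \<in> curve_ideal f; q \<in> curve_ideal f\<rbrakk> \<Longrightarrow> p - q \<in> curve_ideal f"
  using curve_ideal_add[of p f "-1 * q"] curve_ideal_mult[of q f "-1"] by simp

lemma curve_fps_ideal_diff:
  "\<lbrakk>A \<in> curve_fps_ideal f; B \<in> curve_fps_ideal f\<rbrakk> \<Longrightarrow> A - B \<in> curve_fps_ideal f"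
  by (simp add: curve_fps_ideal_def curve_ideal_diff)

lemma half_exists:
  assumes "(2 :: 'a::field) \<noteq> 0"
  shows "\<exists>c :: 'a poly poly poly. 2 * c = 1"
  by (rule exI[of _ "[:[:[:inverse 2:]:]:]"]) (use assms in \<open>simp add: numeral_poly one_pCons\<close>)

lemma diff_in_curve_fps_ideal_iff:
  "A - B \<in> curve_fps_ideal f \<longleftrightarrow> (\<forall>k. curve_class f (fps_nth A k) = curve_class f (fps_nth B k))"
  by (simp add: curve_fps_ideal_def curve_class_eq_iff)

text \<open>A series whose constant term is a unit modulo the ideal, with inverse \<open>u\<close>,
  can be cancelled: coefficient \<open>k\<close> of \<open>A * B\<close> is \<open>A_0 B_k\<close>
  plus terms with earlier coefficients of \<open>B\<close>. Applied to
  \<open>(S + T) * (S - T)\<close>, it shows that two square roots of one series with constant term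
  y coincide, since 2y is a unit.\<close>

lemma curve_fps_ideal_cancel:
  assumes u: "u * fps_nth A 0 - 1 \<in> curve_ideal f" and AB: "A * B \<in> curve_fps_ideal f"
  shows "B \<in> curve_fps_ideal f"
proof -
  have "fps_nth B k \<in> curve_ideal f" for k
  proof (induction k rule: less_induct)
    case (less k)
    let ?S = "\<Sum>i = 1..k. fps_nth A i * fps_nth B (k - i)"
    have "?S \<in> curve_ideal f"
      by (intro curve_ideal_sum curve_ideal_mult less.IH) auto
    moreover have "fps_nth (A * B) k \<in> curve_ideal f"
      using AB by (simp add: curve_fps_ideal_def)
    moreover have "fps_nth (A * B) k = fps_nth A 0 * fps_nth B k + ?S"
      by (simp add: fps_mult_nth sum.atLeast_Suc_atMost)
    ultimately have "u * (fps_nth A 0 * fps_nth B k) \<in> curve_ideal f"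
      using curve_ideal_diff[of "fps_nth (A * B) k" f ?S] by (simp add: curve_ideal_mult)
    then have "u * (fps_nth A 0 * fps_nth B k) - fps_nth B k * (u * fps_nth A 0 - 1) \<in> curve_ideal f"
      by (rule curve_ideal_diff[OF _ curve_ideal_mult[OF u]])
    then show ?case by (simp add: algebra_simps)
  qed
  then show ?thesis by (simp add: curve_fps_ideal_def)
qed

section \<open>Power series\<close>

text \<open>The universal property of a polynomial ring; homomorphisms out of F[x][Y][Z] are built
  by using it once for each variable.\<close>

lemma poly_map_poly_hom:
  assumes "comm_ring_hom h"
  shows "comm_ring_hom (\<lambda>p. poly (map_poly h p) b)"
proof -
  interpret h: comm_ring_hom h by (rule assms)
  interpret m: map_poly_comm_ring_hom h ..
  show ?thesis
    by unfold_locales (simp_all add: m.hom_add m.hom_mult)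
qed

text \<open>The recursion comes from comparing coefficients in U^2 = V with U_0 = 1, where
  \<open>c\<close> stands for 1/2.\<close>

fun fps_sqrt_coeff :: "'b::comm_ring_1 \<Rightarrow> 'b fps \<Rightarrow> nat \<Rightarrow> 'b" where
  "fps_sqrt_coeff c V 0 = 1"
| "fps_sqrt_coeff c V (Suc n) =
     c * (fps_nth V (Suc n) - (\<Sum>i = 1..n. fps_sqrt_coeff c V i * fps_sqrt_coeff c V (Suc n - i)))"

lemma fps_sqrt_exists:
  fixes V :: "'b::comm_ring_1 fps" and c :: 'b
  assumes c: "2 * c = 1" and V: "fps_nth V 0 = 1"
  obtains U where "fps_nth U 0 = 1" "U * U = V"
proof
  let ?U = "Abs_fps (fps_sqrt_coeff c V)"
  show "fps_nth ?U 0 = 1" by simp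
  show "?U * ?U = V"
  proof (rule fps_ext)
    fix n show "fps_nth (?U * ?U) n = fps_nth V n"
    proof (cases n)
      case 0
      then show ?thesis by (simp add: V)
    next
      case (Suc m)
      let ?u = "fps_sqrt_coeff c V"
      \<comment> \<open>Each of the two end terms of the convolution equals
        \<open>?u (Suc m)\<close>, because the constant coefficient is 1.\<close>
      have "{0..Suc m} = insert 0 (insert (Suc m) {1..m})" by auto
      then have "fps_nth (?U * ?U) (Suc m) = 2 * ?u (Suc m) + (\<Sum>i = 1..m. ?u i * ?u (Suc m - i))"
        by (simp add: fps_mult_nth del: fps_sqrt_coeff.simps(2))
      also have "\<dots> = fps_nth V (Suc m)"
        by (simp add: c flip: mult.assoc)
      finally show ?thesis by (simp add: Suc)
    qed
  qed
qed

lemma hasse_deriv_poly_0: "hasse_deriv_poly 0 p = p"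
  by (simp add: hasse_deriv_poly_def poly_as_sum_of_monoms flip: atMost_atLeast0)

lemma const_poly_hom: "comm_ring_hom (\<lambda>p :: 'a::comm_ring_1 poly. [:[:p:]:])"
  by unfold_locales (simp_all add: one_pCons)

text \<open>The expansion of p(x + t) in powers of t, with coefficients placed in F[x][Y][Z] as
  constants in Y and Z.\<close>

definition taylor :: "'a::field poly \<Rightarrow> 'a poly poly poly fps" where
  "taylor p = Abs_fps (\<lambda>k. [:[:hasse_deriv_poly k p:]:])"

lemma taylor_nth [simp]: "fps_nth (taylor p) k = [:[:hasse_deriv_poly k p:]:]"
  by (simp add: taylor_def)

lemma fps_linear_power_nth:
  fixes x :: "'b::comm_ring_1"
  shows "fps_nth ((fps_X + fps_const x) ^ n) k = of_nat (n choose k) * x ^ (n - k)"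
proof -
  have "(fps_X + fps_const x) ^ n =
      (\<Sum>i\<le>n. fps_const (of_nat (n choose i) * x ^ (n - i)) * fps_X ^ i)"
    unfolding binomial_ring
    by (intro sum.cong)
      (simp_all add: fps_const_power fps_of_nat mult_ac flip: fps_const_mult)
  then show ?thesis
    by (simp add: fps_sum_nth fps_X_power_nth if_distrib[of "(*) _"] binomial_eq_0 not_le
        cong: if_cong)
qed

text \<open>The binomial theorem for (x + t)^i turns the explicit coefficients of the Hasse
  derivatives into an evaluation at x + t. Evaluations are homomorphisms, so the Leibniz rule on
  F[x] follows.\<close>

lemma taylor_eq_eval:
  "taylor p = poly (map_poly (\<lambda>a. fps_const [:[:[:a:]:]:]) p) (fps_X + fps_const [:[:[:0, 1:]:]:])"
proof (rule fps_ext)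
  fix k
  interpret K: comm_ring_hom "\<lambda>p :: 'a poly. [:[:p:]:]" by (rule const_poly_hom)
  let ?x = "[:[:[:0, 1:]:]:] :: 'a poly poly poly"
  have mon: "[:[:monom (of_nat n * a) m:]:] = [:[:[:a:]:]:] * (of_nat n * ?x ^ m)"
    for n m and a :: 'a
  proof -
    have "monom (of_nat n * a) m = [:a:] * (of_nat n * [:0, 1:] ^ m)"
      by (simp add: monom_altdef of_nat_poly mult.commute)
    then show ?thesis
      by (simp only: K.hom_mult K.hom_of_nat K.hom_power)
  qed
  have "fps_nth (poly (map_poly (\<lambda>a. fps_const [:[:[:a:]:]:]) p) (fps_X + fps_const ?x)) k =
      (\<Sum>i\<le>degree p. [:[:[:coeff p i:]:]:] * (of_nat (i choose k) * ?x ^ (i - k)))"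
    by (subst eval_poly_def[symmetric], subst eval_poly_as_sum)
      (simp_all add: fps_sum_nth fps_linear_power_nth mult.commute)
  also have "\<dots> = (\<Sum>i\<le>degree p. [:[:monom (of_nat (i choose k) * coeff p i) (i - k):]:])"
    by (simp only: mon)
  also have "\<dots> = (\<Sum>i = k..degree p. [:[:monom (of_nat (i choose k) * coeff p i) (i - k):]:])"
    by (intro sum.mono_neutral_right) (auto simp: not_le binomial_eq_0)
  also have "\<dots> = fps_nth (taylor p) k"
    by (simp add: hasse_deriv_poly_def K.hom_sum)
  finally show "fps_nth (taylor p) k =
      fps_nth (poly (map_poly (\<lambda>a. fps_const [:[:[:a:]:]:]) p) (fps_X + fps_const ?x)) k" ..
qed

lemma taylor_hom: "comm_ring_hom taylor"
proof -
  have "comm_ring_hom (\<lambda>a::'a. fps_const [:[:[:a:]:]:])"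
    by unfold_locales (simp_all add: one_pCons flip: fps_const_add fps_const_mult)
  from poly_map_poly_hom[OF this] show ?thesis
    by (simp add: taylor_eq_eval[abs_def])
qed

section \<open>Hasse derivatives as a homomorphism to power series\<close>

text \<open>A homomorphism R -> R[[t]] lifted to representatives: \<open>const\<close> says that it
  extends the Hasse derivatives of F[x], \<open>nth0\<close> that D^0 is the identity, and
  \<open>ideal_closed\<close> that it descends to R.\<close>

locale hasse_lift = comm_ring_hom \<Phi>
  for \<Phi> :: "'a::field poly poly poly \<Rightarrow> 'a poly poly poly fps" +
  fixes f :: "'a poly"
  assumes two: "(2 :: 'a) \<noteq> 0"
    and const: "\<Phi> [:[:r:]:] = taylor r"
    and nth0: "fps_nth (\<Phi> p) 0 = p"
    and ideal_closed: "p \<in> curve_ideal f \<Longrightarrow> \<Phi> p \<in> curve_fps_ideal f"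

lemma hasse_lift_exists:
  fixes f :: "'a::field poly"
  assumes two: "(2 :: 'a) \<noteq> 0"
  shows "\<exists>\<Phi>. hasse_lift \<Phi> f"
proof -
  let ?J = "curve_fps_ideal f"
  \<comment> \<open>Modulo the ideal, z^2 is 1/f, so \<open>?V\<close> represents f(x + t)/f(x). In
    this form its constant term is exactly 1 already in the polynomial ring.\<close>
  let ?V = "1 + fps_const (var_Z ^ 2) * (taylor f - fps_const [:[:f:]:])"
  obtain c :: "'a poly poly poly" where "2 * c = 1"
    using half_exists[OF two] by blast
  moreover have "fps_nth ?V 0 = 1"
    by (simp add: hasse_deriv_poly_0)
  ultimately obtain U where U0: "fps_nth U 0 = 1" and U: "U * U = ?V"
    by (rule fps_sqrt_exists)
  define W where "W = fps_right_inverse U 1"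
  have W: "U * W = 1" and W0: "fps_nth W 0 = 1"
    using fps_right_inverse[of U 1] U0 by (simp_all add: W_def)
  \<comment> \<open>The variables x, Y, Z go to x + t, yU and zW. As W is the inverse of U, the
    product yz is fixed.\<close>
  define \<Psi> where "\<Psi> q = poly (map_poly taylor q) (fps_const var_Y * U)" for q :: "'a poly poly"
  define \<Phi> where "\<Phi> p = poly (map_poly \<Psi> p) (fps_const var_Z * W)" for p :: "'a poly poly poly"
  interpret T: comm_ring_hom "taylor :: 'a poly \<Rightarrow> _" by (rule taylor_hom)
  interpret \<Psi>: comm_ring_hom \<Psi>
    unfolding \<Psi>_def[abs_def] by (rule poly_map_poly_hom[OF taylor_hom])
  interpret \<Phi>: comm_ring_hom \<Phi>
    unfolding \<Phi>_def[abs_def] by (rule poly_map_poly_hom[OF \<Psi>.comm_ring_hom_axioms])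
  have \<Psi>_pCons: "\<Psi> (pCons a q) = taylor a + fps_const var_Y * U * \<Psi> q" for a q
    by (simp add: \<Psi>_def T.map_poly_pCons_hom)
  have \<Phi>_pCons: "\<Phi> (pCons q p) = \<Psi> q + fps_const var_Z * W * \<Phi> p" for q p
    by (simp add: \<Phi>_def \<Psi>.map_poly_pCons_hom)
  have \<Psi>0: "fps_nth (\<Psi> q) 0 = [:q:]" for q
    by (induction q) (simp_all add: \<Psi>_pCons U0 hasse_deriv_poly_0 var_Y_def)
  have \<Phi>0: "fps_nth (\<Phi> p) 0 = p" for p
    by (induction p) (simp_all add: \<Phi>_pCons W0 \<Psi>0 var_Z_def)
  have const: "\<Phi> [:[:p:]:] = taylor p" for p
    by (simp add: \<Phi>_pCons \<Psi>_pCons)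
  have Y: "\<Phi> var_Y = fps_const var_Y * U"
    by (subst var_Y_def) (simp add: \<Phi>_pCons \<Psi>_pCons flip: one_pCons)
  have Z: "\<Phi> var_Z = fps_const var_Z * W"
    by (subst var_Z_def) (simp add: \<Phi>_pCons flip: one_pCons)
  have closed: "curve_ideal f \<subseteq> {p. \<Phi> p \<in> ?J}"
  proof (rule curve_ideal_subsetI)
    have "\<Phi> (var_Y ^ 2) = fps_const (var_Y ^ 2) * ?V"
      unfolding \<Phi>.hom_power Y power_mult_distrib fps_const_power
      by (simp only: power2_eq_square[of U] U)
    then have "\<Phi> (var_Y ^ 2 - [:[:f:]:]) = fps_const (var_Y ^ 2) * ?V - taylor f"
      by (simp only: \<Phi>.hom_minus const)
    \<comment> \<open>With T = f(x + t) - f(x), the difference is (y^2 - f) + T (y^2 z^2 - 1), and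
      the second bracket is divisible by yz - 1.\<close>
    also have "\<dots> = fps_const (var_Y ^ 2 - [:[:f:]:]) +
        (taylor f - fps_const [:[:f:]:]) * fps_const (var_Y * var_Z + 1) * fps_const (var_Y * var_Z - 1)"
      by (simp add: algebra_simps power2_eq_square
          flip: fps_const_mult fps_const_add fps_const_sub)
    also have "\<dots> \<in> ?J"
      by (intro curve_fps_ideal_add curve_fps_ideal_mult curve_fps_ideal_const
          curve_ideal_generators)
    finally show "var_Y ^ 2 - [:[:f:]:] \<in> {p. \<Phi> p \<in> ?J}" by simp
  next
    have "\<Phi> (var_Y * var_Z - 1) = fps_const (var_Y * var_Z) * (U * W) - 1"
      by (simp add: \<Phi>.hom_minus \<Phi>.hom_mult Y Z mult_ac flip: fps_const_mult)
    also have "\<dots> = fps_const (var_Y * var_Z - 1)"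
      by (simp add: W flip: fps_const_sub)
    also have "\<dots> \<in> ?J"
      by (intro curve_fps_ideal_const curve_ideal_generators)
    finally show "var_Y * var_Z - 1 \<in> {p. \<Phi> p \<in> ?J}" by simp
  next
    show "0 \<in> {p. \<Phi> p \<in> ?J}"
      by (simp add: curve_fps_ideal_def curve_ideal_zero)
  qed (auto simp: \<Phi>.hom_add \<Phi>.hom_mult intro: curve_fps_ideal_add curve_fps_ideal_mult)
  show ?thesis
    by (intro exI[of _ \<Phi>] hasse_lift.intro hasse_lift_axioms.intro \<Phi>.comm_ring_hom_axioms)
      (use two const \<Phi>0 closed in auto)
qed

section \<open>The Hasse derivatives induced by a lift\<close>

context hasse_lift
begin

lemma lift_cong:
  "curve_class f p = curve_class f q \<Longrightarrow>
     curve_class f (fps_nth (\<Phi> p) k) = curve_class f (fps_nth (\<Phi> q) k)"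
  using ideal_closed[of "p - q"]
  by (simp add: curve_class_eq_iff curve_fps_ideal_def hom_minus)

text \<open>By \<open>lift_cong\<close> the chosen representative does not affect the resulting
  class. The restriction fixes the values off the carrier, as the extensional function space in
  \<open>is_hasse_extension\<close> demands.\<close>

definition lift_deriv :: "nat \<Rightarrow> 'a poly poly poly set \<Rightarrow> 'a poly poly poly set" where
  "lift_deriv k = restrict
     (\<lambda>c. curve_class f (fps_nth (\<Phi> (inv_into UNIV (curve_class f) c)) k)) (carrier (curve_ring f))"

lemma lift_deriv_class: "lift_deriv k (curve_class f p) = curve_class f (fps_nth (\<Phi> p) k)"
proof -
  have "curve_class f (inv_into UNIV (curve_class f) (curve_class f p)) = curve_class f p"
    by (simp add: f_inv_into_f)
  from lift_cong[OF this] show ?thesis by (simp add: lift_deriv_def)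
qed

lemma is_hasse_extension_lift: "is_hasse_extension f lift_deriv"
proof -
  have "lift_deriv k \<in> carrier (curve_ring f) \<rightarrow>\<^sub>E carrier (curve_ring f)" for k
    by (auto simp: lift_deriv_def)
  moreover have "fps_nth (\<Phi> ([:[:[:c:]:]:] * p)) k = [:[:[:c:]:]:] * fps_nth (\<Phi> p) k" for c p k
  proof -
    have "taylor [:c:] = fps_const [:[:[:c:]:]:]"
      by (rule fps_ext) (simp add: hasse_deriv_poly_def monom_0)
    then show ?thesis by (simp only: hom_mult const fps_mult_left_const_nth)
  qed
  ultimately show ?thesis
    unfolding is_hasse_extension_def Let_def
    by (simp only: carrier_curve_ring ball_simps lift_deriv_class curve_class_add
        curve_class_mult curve_of_poly_class hom_add hom_mult fps_add_nth nth0 const taylor_nth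
        curve_class_finsum[OF finite_atLeastAtMost] fps_mult_nth atMost_atLeast0 simp_thms)
qed

text \<open>Any extension gives a series map that is additive and multiplicative modulo the ideal
  and agrees with \<Phi> on F[x]. Both send y to a square root of f(x + t) with constant term y, so
  they agree on y; from yz = 1 they agree on z, and induction over polynomials gives all of
  R.\<close>

lemma is_hasse_extension_unique:
  assumes "is_hasse_extension f D"
  shows "D = lift_deriv"
proof -
  let ?J = "curve_fps_ideal f"
  note ext = assms[unfolded is_hasse_extension_def Let_def curve_of_poly_class]
  note ext_add = ext[THEN conjunct2, THEN conjunct1, rule_format]
  note ext_const = ext[THEN conjunct2, THEN conjunct2, THEN conjunct2, THEN conjunct1, rule_format]
  note ext_0 = ext[THEN conjunct2, THEN conjunct2, THEN conjunct2, THEN conjunct2, THEN conjunct1,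
      rule_format]
  note ext_mult = ext[THEN conjunct2, THEN conjunct2, THEN conjunct2, THEN conjunct2,
      THEN conjunct2, rule_format]
  have D_PiE: "D k \<in> carrier (curve_ring f) \<rightarrow>\<^sub>E carrier (curve_ring f)" for k
    by (rule ext[THEN conjunct1, rule_format])
  have closed: "D k (curve_class f p) \<in> carrier (curve_ring f)" for k p
    using PiE_mem[OF D_PiE curve_class_closed] .
  have D_add: "D k (curve_class f (p + q)) =
      D k (curve_class f p) \<oplus>\<^bsub>curve_ring f\<^esub> D k (curve_class f q)"
    and D_mult: "D k (curve_class f (p * q)) =
      (\<Oplus>\<^bsub>curve_ring f\<^esub>i\<in>{..k}. D i (curve_class f p) \<otimes>\<^bsub>curve_ring f\<^esub> D (k - i) (curve_class f q))"
    and D_const: "D k (curve_class f [:[:r:]:]) = curve_class f [:[:hasse_deriv_poly k r:]:]"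
    and D_0: "D 0 (curve_class f p) = curve_class f p" for k p q r
    unfolding curve_class_add[symmetric] curve_class_mult[symmetric]
    by (rule ext_add ext_mult ext_const ext_0; rule curve_class_closed)+
  \<comment> \<open>Representatives of the coefficients are chosen arbitrarily, so sums and products
    are respected only modulo \<open>?J\<close>; on equal classes, however, the chosen series are
    equal.\<close>
  define \<Delta> where "\<Delta> p = Abs_fps (\<lambda>k. inv_into UNIV (curve_class f) (D k (curve_class f p)))" for p
  have \<Delta>: "curve_class f (fps_nth (\<Delta> p) k) = D k (curve_class f p)" for p k
    using closed[of k p] by (simp add: \<Delta>_def f_inv_into_f carrier_curve_ring)
  have \<Delta>_cong: "\<Delta> p = \<Delta> q" if "curve_class f p = curve_class f q" for p q
    using that by (simp add: \<Delta>_def)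
  have \<Delta>_add: "\<Delta> (p + q) - (\<Delta> p + \<Delta> q) \<in> ?J" for p q
    unfolding diff_in_curve_fps_ideal_iff \<Delta> D_add
    by (simp only: fps_add_nth \<Delta> simp_thms flip: curve_class_add)
  have \<Delta>_mult: "\<Delta> (p * q) - \<Delta> p * \<Delta> q \<in> ?J" for p q
    unfolding diff_in_curve_fps_ideal_iff \<Delta> D_mult
    by (simp only: fps_mult_nth atMost_atLeast0 \<Delta> finite_atLeastAtMost simp_thms
        flip: curve_class_finsum curve_class_mult)
  have \<Delta>_const: "\<Delta> [:[:r:]:] - \<Phi> [:[:r:]:] \<in> ?J" for r
    by (simp add: diff_in_curve_fps_ideal_iff \<Delta> D_const const)
  have \<Delta>_0: "fps_nth (\<Delta> p) 0 - p \<in> curve_ideal f" for p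
    by (simp add: \<Delta> D_0 flip: curve_class_eq_iff)
  have add: "\<Delta> (p + q) - \<Phi> (p + q) \<in> ?J"
    if "\<Delta> p - \<Phi> p \<in> ?J" "\<Delta> q - \<Phi> q \<in> ?J" for p q
    using curve_fps_ideal_add[OF \<Delta>_add[of p q] curve_fps_ideal_add[OF that]]
    by (simp add: hom_add algebra_simps)
  have mult: "\<Delta> (p * q) - \<Phi> (p * q) \<in> ?J"
    if "\<Delta> p - \<Phi> p \<in> ?J" "\<Delta> q - \<Phi> q \<in> ?J" for p q
    using curve_fps_ideal_add[OF \<Delta>_mult[of p q] curve_fps_ideal_add[OF
        curve_fps_ideal_mult[OF that(1), of "\<Phi> q"] curve_fps_ideal_mult[OF that(2), of "\<Delta> p"]]]
    by (simp add: hom_mult algebra_simps)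
  obtain c :: "'a poly poly poly" where c: "2 * c = 1"
    using half_exists[OF two] by blast
  have Y: "\<Delta> var_Y - \<Phi> var_Y \<in> ?J"
  proof (rule curve_fps_ideal_cancel)
    \<comment> \<open>The sum of the two square roots has constant term 2y modulo the ideal, with
      inverse z/2.\<close>
    have "var_Z * c * fps_nth (\<Delta> var_Y + \<Phi> var_Y) 0 - 1 =
        var_Z * c * (fps_nth (\<Delta> var_Y) 0 - var_Y) + (var_Y * var_Z * (2 * c) - 1)"
      by (simp add: nth0 algebra_simps)
    also have "\<dots> \<in> curve_ideal f"
      unfolding c mult_1_right
      by (intro curve_ideal_add curve_ideal_mult \<Delta>_0 curve_ideal_generators)
    finally show "var_Z * c * fps_nth (\<Delta> var_Y + \<Phi> var_Y) 0 - 1 \<in> curve_ideal f" .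
    have "\<Delta> (var_Y * var_Y) = \<Delta> [:[:f:]:]"
      using curve_class_Y_square by (intro \<Delta>_cong) (simp add: power2_eq_square)
    moreover have "(\<Delta> var_Y + \<Phi> var_Y) * (\<Delta> var_Y - \<Phi> var_Y) =
        (\<Delta> [:[:f:]:] - \<Phi> [:[:f:]:]) - (\<Delta> [:[:f:]:] - \<Delta> var_Y * \<Delta> var_Y)
        - \<Phi> (var_Y ^ 2 - [:[:f:]:])"
      by (simp add: hom_minus hom_mult power2_eq_square algebra_simps)
    ultimately show "(\<Delta> var_Y + \<Phi> var_Y) * (\<Delta> var_Y - \<Phi> var_Y) \<in> ?J"
      using curve_fps_ideal_diff[OF curve_fps_ideal_diff[OF \<Delta>_const[of f] \<Delta>_mult[of var_Y var_Y]]
          ideal_closed[OF curve_ideal_generators(1)]] by simp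
  qed
  have Z: "\<Delta> var_Z - \<Phi> var_Z \<in> ?J"
  proof (rule curve_fps_ideal_cancel)
    show "var_Z * fps_nth (\<Phi> var_Y) 0 - 1 \<in> curve_ideal f"
      using curve_ideal_generators(2) by (simp add: nth0 mult.commute)
    have "\<Delta> (var_Y * var_Z) = \<Delta> [:[:1:]:]"
      using curve_class_Y_Z by (intro \<Delta>_cong) (simp flip: one_pCons)
    moreover have "\<Phi> var_Y * (\<Delta> var_Z - \<Phi> var_Z) =
        (\<Delta> [:[:1:]:] - \<Phi> [:[:1:]:]) - (\<Delta> [:[:1:]:] - \<Delta> var_Y * \<Delta> var_Z)
        - \<Phi> (var_Y * var_Z - 1) - \<Delta> var_Z * (\<Delta> var_Y - \<Phi> var_Y)"
      by (simp add: hom_minus hom_mult algebra_simps flip: one_pCons)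
    ultimately show "\<Phi> var_Y * (\<Delta> var_Z - \<Phi> var_Z) \<in> ?J"
      using curve_fps_ideal_diff[OF curve_fps_ideal_diff[OF curve_fps_ideal_diff[OF
          \<Delta>_const[of 1] \<Delta>_mult[of var_Y var_Z]] ideal_closed[OF curve_ideal_generators(2)]]
          curve_fps_ideal_mult[OF Y, of "\<Delta> var_Z"]] by simp
  qed
  have inner: "\<Delta> [:q:] - \<Phi> [:q:] \<in> ?J" for q
  proof (induction q)
    case 0
    show ?case using \<Delta>_const[of 0] by simp
  next
    case (pCons a q)
    have "[:pCons a q:] = [:[:a:]:] + var_Y * [:q:]" by (simp add: var_Y_def)
    then show ?case using add[OF \<Delta>_const[of a] mult[OF Y pCons.IH]] by simp
  qed
  have all: "\<Delta> p - \<Phi> p \<in> ?J" for p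
  proof (induction p)
    case 0
    show ?case using \<Delta>_const[of 0] by simp
  next
    case (pCons q p)
    have "pCons q p = [:q:] + var_Z * p" by (simp add: var_Z_def)
    then show ?case using add[OF inner[of q] mult[OF Z pCons.IH]] by simp
  qed
  have "D k c = lift_deriv k c" for k c
  proof (cases "c \<in> carrier (curve_ring f)")
    case True
    then obtain p where p: "c = curve_class f p" by (auto simp: carrier_curve_ring)
    have "curve_class f (fps_nth (\<Delta> p) k) = curve_class f (fps_nth (\<Phi> p) k)"
      using all[of p] by (simp add: curve_fps_ideal_def curve_class_eq_iff)
    then show ?thesis by (simp add: p \<Delta> lift_deriv_class)
  next
    case False
    then show ?thesis
      using PiE_arb[OF D_PiE] by (simp add: lift_deriv_def)
  qed
  then show ?thesis by (simp add: fun_eq_iff)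
qed

text \<open>Existence and uniqueness resolve the definite description; from here on a Hasse
  derivative is a coefficient of \<Phi>.\<close>

lemma hasse_deriv_class:
  "hasse_deriv f k (curve_class f p) = curve_class f (fps_nth (\<Phi> p) k)"
proof -
  have "hasse_deriv f = lift_deriv"
    unfolding hasse_deriv_def
    by (rule the_equality) (rule is_hasse_extension_lift is_hasse_extension_unique; assumption?)+
  then show ?thesis by (simp add: lift_deriv_class)
qed

end

section \<open>Substitution in integer polynomials\<close>

lemma thomogeneous_add:
  "\<lbrakk>thomogeneous d p; thomogeneous d q\<rbrakk> \<Longrightarrow> thomogeneous d (p + q)"
  unfolding thomogeneous_def using keys_add[of p q] by blast

lemma thomogeneous_zero: "thomogeneous d 0"
  by (simp add: thomogeneous_def)

lemma thomogeneous_one: "thomogeneous 0 1"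
  by (simp add: thomogeneous_def)

lemma thomogeneous_uminus: "thomogeneous d p \<Longrightarrow> thomogeneous d (- p)"
  by (simp add: thomogeneous_def)

lemma thomogeneous_mult:
  assumes "thomogeneous d p" "thomogeneous e q"
  shows "thomogeneous (d + e) (p * q)"
  unfolding thomogeneous_def
proof
  fix m assume "m \<in> Poly_Mapping.keys (p * q)"
  then obtain m1 m2 where m: "m = m1 + m2"
    and "m1 \<in> Poly_Mapping.keys p" "m2 \<in> Poly_Mapping.keys q"
    using keys_mult[of p q] by blast
  then have d: "(\<Sum>i\<in>Poly_Mapping.keys m1. Poly_Mapping.lookup m1 i) = d"
    and e: "(\<Sum>i\<in>Poly_Mapping.keys m2. Poly_Mapping.lookup m2 i) = e"
    using assms by (auto simp: thomogeneous_def)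
  have "(\<Sum>i\<in>Poly_Mapping.keys m. Poly_Mapping.lookup m i) =
      (\<Sum>i\<in>Poly_Mapping.keys m1. Poly_Mapping.lookup m1 i) +
      (\<Sum>i\<in>Poly_Mapping.keys m2. Poly_Mapping.lookup m2 i)"
    unfolding m by (rule setsum_keys_plus_distrib) auto
  then show "(\<Sum>i\<in>Poly_Mapping.keys m. Poly_Mapping.lookup m i) = d + e"
    by (simp add: d e)
qed

lemma thomogeneous_sum:
  "(\<And>i. i \<in> A \<Longrightarrow> thomogeneous d (p i)) \<Longrightarrow> thomogeneous d (\<Sum>i\<in>A. p i)"
  by (induction A rule: infinite_finite_induct)
    (simp_all add: thomogeneous_zero thomogeneous_add)

lemma thomogeneous_prod:
  assumes "\<And>i. i \<in> A \<Longrightarrow> thomogeneous 1 (p i)"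
  shows "thomogeneous (card A) (\<Prod>i\<in>A. p i)"
  using assms
proof (induction A rule: infinite_finite_induct)
  case (insert a A)
  then show ?case
    using thomogeneous_mult[of 1 "p a" "card A" "\<Prod>i\<in>A. p i"] by simp
qed (simp_all add: thomogeneous_one)

lemma thomogeneous_tvar: "thomogeneous 1 (tvar i)"
  by (simp add: thomogeneous_def tvar_def)

lemma tvars_add: "tvars (p + q) \<subseteq> tvars p \<union> tvars q"
  unfolding tvars_def using keys_add[of p q] by blast

lemma tvars_mult: "tvars (p * q) \<subseteq> tvars p \<union> tvars q"
proof
  fix i assume "i \<in> tvars (p * q)"
  then obtain m where "m \<in> Poly_Mapping.keys (p * q)" and i: "i \<in> Poly_Mapping.keys m"
    by (auto simp: tvars_def)
  then obtain m1 m2 where m: "m = m1 + m2"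
    and "m1 \<in> Poly_Mapping.keys p" "m2 \<in> Poly_Mapping.keys q"
    using keys_mult[of p q] by blast
  then show "i \<in> tvars p \<union> tvars q"
    using i keys_add[of m1 m2] by (auto simp: tvars_def)
qed

lemma tvars_uminus [simp]: "tvars (- p) = tvars p"
  by (simp add: tvars_def)

lemma tvars_sum: "tvars (\<Sum>i\<in>A. p i) \<subseteq> (\<Union>i\<in>A. tvars (p i))"
proof (induction A rule: infinite_finite_induct)
  case (insert a A)
  then show ?case using tvars_add[of "p a" "\<Sum>i\<in>A. p i"] by auto
qed (simp_all add: tvars_def)

lemma tvars_prod: "tvars (\<Prod>i\<in>A. p i) \<subseteq> (\<Union>i\<in>A. tvars (p i))"
proof (induction A rule: infinite_finite_induct)
  case (insert a A)
  then show ?case using tvars_mult[of "p a" "\<Prod>i\<in>A. p i"] by auto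
qed (simp_all add: tvars_def)

lemma tvars_tvar: "tvars (tvar i) = {i}"
  by (simp add: tvars_def tvar_def)

lemma Q_poly_Leibniz:
  "Q_poly \<mu> = (\<Sum>\<pi> | \<pi> permutes {0..<\<mu>}.
     signof \<pi> * (\<Prod>i = 0..<\<mu>. tvar (int (\<pi> i) - int i)))"
  by (simp only: Q_poly_def det_mat_Leibniz)

lemma thomogeneous_Q_poly: "thomogeneous \<mu> (Q_poly \<mu>)"
  unfolding Q_poly_Leibniz
proof (rule thomogeneous_sum)
  fix \<pi> :: "nat \<Rightarrow> nat"
  have "thomogeneous \<mu> (\<Prod>i = 0..<\<mu>. tvar (int (\<pi> i) - int i))"
    using thomogeneous_prod[of "{0..<\<mu>}" "\<lambda>i. tvar (int (\<pi> i) - int i)"]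
      thomogeneous_tvar by simp
  then show "thomogeneous \<mu> (signof \<pi> * (\<Prod>i = 0..<\<mu>. tvar (int (\<pi> i) - int i)))"
    by (simp add: sign_def thomogeneous_uminus)
qed

text \<open>Every index that occurs is a difference of two naturals below
  \<open>\<mu>\<close>.\<close>

lemma tvars_Q_poly: "tvars (Q_poly \<mu>) \<subseteq> {- int \<mu>..int \<mu> - 1}"
proof -
  have "tvars (signof \<pi> * (\<Prod>i = 0..<\<mu>. tvar (int (\<pi> i) - int i))) \<subseteq> {- int \<mu>..int \<mu> - 1}"
    if "\<pi> permutes {0..<\<mu>}" for \<pi>
  proof -
    have "\<pi> i < \<mu>" if "i < \<mu>" for i
      using permutes_in_image[OF \<open>\<pi> permutes {0..<\<mu>}\<close>, of i] that by simp
    then have "(\<Union>i\<in>{0..<\<mu>}. tvars (tvar (int (\<pi> i) - int i))) \<subseteq> {- int \<mu>..int \<mu> - 1}"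
      by (fastforce simp: tvars_tvar)
    then have "tvars (\<Prod>i = 0..<\<mu>. tvar (int (\<pi> i) - int i)) \<subseteq> {- int \<mu>..int \<mu> - 1}"
      using tvars_prod by (rule order_trans[rotated])
    then show ?thesis by (simp add: sign_def)
  qed
  then show ?thesis
    unfolding Q_poly_Leibniz by (intro order_trans[OF tvars_sum] UN_least) auto
qed

section \<open>Substitution as a ring homomorphism\<close>

definition tmonom_eval :: "(int \<Rightarrow> 'b::comm_ring_1) \<Rightarrow> (int \<Rightarrow>\<^sub>0 nat) \<Rightarrow> 'b" where
  "tmonom_eval a m = (\<Prod>i\<in>Poly_Mapping.keys m. a i ^ Poly_Mapping.lookup m i)"

text \<open>Exponents off the support are 0 and give factors 1. A common index set for two monomials
  makes evaluation multiplicative; \<open>tsubst_superset\<close> does the same for sums.\<close>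

lemma tmonom_eval_superset:
  assumes "finite S" "Poly_Mapping.keys m \<subseteq> S"
  shows "tmonom_eval a m = (\<Prod>i\<in>S. a i ^ Poly_Mapping.lookup m i)"
  unfolding tmonom_eval_def using assms
  by (intro prod.mono_neutral_left) (auto simp: in_keys_iff)

lemma tmonom_eval_add: "tmonom_eval a (m + n) = tmonom_eval a m * tmonom_eval a n"
proof -
  let ?S = "Poly_Mapping.keys m \<union> Poly_Mapping.keys n"
  have "tmonom_eval a (m + n) = (\<Prod>i\<in>?S. a i ^ Poly_Mapping.lookup (m + n) i)"
    by (rule tmonom_eval_superset) (use keys_add[of m n] in auto)
  also have "\<dots> = tmonom_eval a m * tmonom_eval a n"
    by (simp add: tmonom_eval_superset[of ?S] lookup_add power_add prod.distrib)
  finally show ?thesis .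
qed

lemma tsubst_superset:
  assumes "finite S" "Poly_Mapping.keys q \<subseteq> S"
  shows "tsubst a q = (\<Sum>m\<in>S. of_int (Poly_Mapping.lookup q m) * tmonom_eval a m)"
  unfolding tsubst_def tmonom_eval_def using assms
  by (intro sum.mono_neutral_left) (auto simp: in_keys_iff)

lemma tsubst_add: "tsubst a (p + q) = tsubst a p + tsubst a q"
proof -
  let ?S = "Poly_Mapping.keys p \<union> Poly_Mapping.keys q"
  have "tsubst a (p + q) = (\<Sum>m\<in>?S. of_int (Poly_Mapping.lookup (p + q) m) * tmonom_eval a m)"
    by (rule tsubst_superset) (use keys_add[of p q] in auto)
  also have "\<dots> = tsubst a p + tsubst a q"
    by (simp add: tsubst_superset[of ?S] lookup_add distrib_right sum.distrib)
  finally show ?thesis .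
qed

lemma tsubst_zero: "tsubst a 0 = 0"
  by (simp add: tsubst_def)

lemma tsubst_single: "tsubst a (Poly_Mapping.single m c) = of_int c * tmonom_eval a m"
  by (subst tsubst_superset[of "{m}"]) auto

lemma tsubst_sum: "tsubst a (\<Sum>i\<in>A. p i) = (\<Sum>i\<in>A. tsubst a (p i))"
  by (induction A rule: infinite_finite_induct) (simp_all add: tsubst_zero tsubst_add)

lemma tpoly_eq_sum_single:
  fixes q :: tpoly
  shows "q = (\<Sum>m\<in>Poly_Mapping.keys q. Poly_Mapping.single m (Poly_Mapping.lookup q m))"
  by (rule poly_mapping_eqI) (auto simp: lookup_sum lookup_single when_def in_keys_iff)

text \<open>Expanding both factors into monomials reduces the claim to
  \<open>tmonom_eval_add\<close>.\<close>

lemma tsubst_mult: "tsubst a (p * q) = tsubst a p * tsubst a q"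
proof -
  have "tsubst a (p * q) =
      tsubst a (\<Sum>m\<in>Poly_Mapping.keys p. \<Sum>n\<in>Poly_Mapping.keys q.
        Poly_Mapping.single (m + n) (Poly_Mapping.lookup p m * Poly_Mapping.lookup q n))"
    by (subst tpoly_eq_sum_single[of p], subst tpoly_eq_sum_single[of q])
      (simp add: sum_product mult_single)
  also have "\<dots> = (\<Sum>m\<in>Poly_Mapping.keys p. \<Sum>n\<in>Poly_Mapping.keys q.
      (of_int (Poly_Mapping.lookup p m) * tmonom_eval a m) *
      (of_int (Poly_Mapping.lookup q n) * tmonom_eval a n))"
    by (simp add: tsubst_sum tsubst_single tmonom_eval_add mult_ac)
  also have "\<dots> = tsubst a p * tsubst a q"
    by (simp add: tsubst_def tmonom_eval_def sum_product)
  finally show ?thesis .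
qed

lemma tsubst_tvar: "tsubst a (tvar i) = a i"
  by (simp add: tvar_def tsubst_single tmonom_eval_def)

lemma tsubst_hom: "comm_ring_hom (tsubst a)"
proof
  show "tsubst a 1 = 1"
    using tsubst_single[of a 0 1] by (simp add: tmonom_eval_def)
qed (simp_all add: tsubst_add tsubst_mult tsubst_zero)

text \<open>Homomorphisms commute with determinants, so the substituted polynomial is a Toeplitz
  determinant.\<close>

lemma tsubst_Q_poly:
  "tsubst a (Q_poly \<mu>) = det (mat \<mu> \<mu> (\<lambda>(i, j). a (int j - int i)))"
proof -
  interpret comm_ring_hom "tsubst a" by (rule tsubst_hom)
  have "map_mat (tsubst a) (mat \<mu> \<mu> (\<lambda>(i, j). tvar (int j - int i))) =
      mat \<mu> \<mu> (\<lambda>(i, j). a (int j - int i))"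
    by (rule eq_matI) (auto simp: tsubst_tvar)
  then show ?thesis by (simp add: Q_poly_def flip: hom_det)
qed

section \<open>Inflection polynomials\<close>

text \<open>The ring maps to the algebraic closure of \<open>F(x)\<close>, with \<open>y\<close> going to a square root of \<open>f\<close>.\<close>

lemma curve_class_of_poly_inj:
  fixes f :: "'a::field poly"
  assumes f: "f \<noteq> 0" and eq: "curve_class f [:[:p:]:] = curve_class f [:[:q:]:]"
  shows "p = q"
proof -
  define h where "h r = to_ac (to_fract r)" for r :: "'a poly"
  obtain s where s: "s ^ 2 = h f"
    using nth_root_exists[of 2 "h f"] by auto
  have "s \<noteq> 0"
    using s f by (auto simp: h_def)
  interpret h: comm_ring_hom h
    by unfold_locales (simp_all add: h_def)
  define \<psi> where "\<psi> r = poly (map_poly h r) s" for r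
  define \<phi> where "\<phi> r = poly (map_poly \<psi> r) (inverse s)" for r
  interpret \<psi>: comm_ring_hom \<psi>
    unfolding \<psi>_def[abs_def] by (rule poly_map_poly_hom[OF h.comm_ring_hom_axioms])
  interpret \<phi>: comm_ring_hom \<phi>
    unfolding \<phi>_def[abs_def] by (rule poly_map_poly_hom[OF \<psi>.comm_ring_hom_axioms])
  have \<psi>_pCons: "\<psi> (pCons a r) = h a + s * \<psi> r" for a r
    by (simp add: \<psi>_def h.map_poly_pCons_hom)
  have \<phi>_pCons: "\<phi> (pCons a r) = \<psi> a + inverse s * \<phi> r" for a r
    by (simp add: \<phi>_def \<psi>.map_poly_pCons_hom)
  have const: "\<phi> [:[:r:]:] = h r" for r
    by (simp add: \<phi>_pCons \<psi>_pCons)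
  have "\<phi> var_Y = s" "\<phi> var_Z = inverse s"
    by (simp_all add: var_Y_def var_Z_def \<phi>_pCons \<psi>_pCons flip: one_pCons)
  then have "curve_ideal f \<subseteq> {r. \<phi> r = 0}"
    using \<open>s \<noteq> 0\<close>
    by (intro curve_ideal_subsetI)
      (simp_all add: \<phi>.hom_add \<phi>.hom_mult \<phi>.hom_minus \<phi>.hom_power const s)
  then have "\<phi> ([:[:p:]:] - [:[:q:]:]) = 0"
    using eq by (auto simp: curve_class_eq_iff)
  then show "p = q"
    by (simp add: \<phi>.hom_minus const) (simp add: h_def)
qed

lemma curve_class_Y_Z_power: "curve_class f ((var_Y * var_Z) ^ n) = curve_class f 1"
  by (metis curve_class_Y_Z curve_class_pow power_one)

text \<open>From y^2 = f and yz = 1, the class of z^2 is the inverse of f; negative powers of f are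
  therefore written as even powers of z.\<close>

lemma curve_class_f_Z: "curve_class f ([:[:f:]:] * var_Z ^ 2) = curve_class f 1"
  using curve_class_cong_mult[OF curve_class_Y_square[symmetric] refl, of f "var_Z ^ 2"]
    curve_class_Y_Z_power[of f 2]
  by (simp add: power_mult_distrib)

section \<open>The Hasse derivatives of y\<close>

context hasse_lift
begin

lemma lift_Y_square: "\<Phi> var_Y ^ 2 - taylor f \<in> curve_fps_ideal f"
  using ideal_closed[OF curve_ideal_generators(1)] by (simp add: hom_minus hom_power const)

text \<open>Replacing t by ft in f(x + t)/f(x) clears the denominators, so the square root
  \<open>P\<close> of the new series lives over F[x]. Then y P(t/f) and the image of y are square
  roots of f(x + t) with constant term y, hence equal modulo the ideal.\<close>

lemma lift_Y:
  obtains P :: "'a poly fps" where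
    "\<And>k. curve_class f (fps_nth (\<Phi> var_Y) k) =
       curve_class f (var_Y * var_Z ^ (2 * k) * [:[:fps_nth P k:]:])"
proof -
  interpret K: comm_ring_hom "\<lambda>p :: 'a poly. [:[:p:]:]" by (rule const_poly_hom)
  \<comment> \<open>This is f(x + ft)/f(x); the case \<open>k = 0\<close> is the quotient of f by
    itself.\<close>
  define V where "V = Abs_fps (\<lambda>k. if k = 0 then 1 else f ^ (k - 1) * hasse_deriv_poly k f)"
  have V: "f * fps_nth V k = f ^ k * hasse_deriv_poly k f" for k
    by (cases k) (simp_all add: V_def hasse_deriv_poly_0)
  have "2 * [:inverse 2 :: 'a:] = 1"
    using two by (simp add: numeral_poly one_pCons)
  moreover have "fps_nth V 0 = 1" by (simp add: V_def)
  ultimately obtain P where P0: "fps_nth P 0 = 1" and P: "P * P = V"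
    by (rule fps_sqrt_exists)
  \<comment> \<open>The series y P(t/f), with z^2 in the role of 1/f.\<close>
  define Q where "Q = Abs_fps (\<lambda>k. var_Y * var_Z ^ (2 * k) * [:[:fps_nth P k:]:])"
  have Q_square: "fps_nth (Q ^ 2) k = var_Y ^ 2 * (var_Z ^ (2 * k) * [:[:fps_nth V k:]:])" for k
  proof -
    have "fps_nth (Q ^ 2) k = (\<Sum>i = 0..k. var_Y ^ 2 * (var_Z ^ (2 * k) *
        ([:[:fps_nth P i:]:] * [:[:fps_nth P (k - i):]:])))"
      unfolding power2_eq_square[of Q] fps_mult_nth
    proof (rule sum.cong[OF refl])
      fix i assume "i \<in> {0..k}"
      then have "2 * k = 2 * i + 2 * (k - i)" by simp
      then have "var_Z ^ (2 * k) = var_Z ^ (2 * i) * (var_Z ^ (2 * (k - i)) :: 'a poly poly poly)"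
        by (metis power_add)
      then show "fps_nth Q i * fps_nth Q (k - i) = var_Y ^ 2 * (var_Z ^ (2 * k) *
          ([:[:fps_nth P i:]:] * [:[:fps_nth P (k - i):]:]))"
        unfolding Q_def fps_nth_Abs_fps by (simp only: power2_eq_square mult_ac)
    qed
    also have "\<dots> = var_Y ^ 2 * (var_Z ^ (2 * k) * [:[:fps_nth (P * P) k:]:])"
      by (simp only: fps_mult_nth K.hom_sum K.hom_mult sum_distrib_left)
    finally show ?thesis by (simp only: P)
  qed
  have "taylor f - Q ^ 2 \<in> curve_fps_ideal f"
    unfolding diff_in_curve_fps_ideal_iff
  proof
    fix k
    have "curve_class f (fps_nth (Q ^ 2) k) =
        curve_class f ([:[:f:]:] * (var_Z ^ (2 * k) * [:[:fps_nth V k:]:]))"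
      unfolding Q_square by (rule curve_class_cong_mult[OF curve_class_Y_square refl])
    also have "[:[:f:]:] * (var_Z ^ (2 * k) * [:[:fps_nth V k:]:]) =
        var_Z ^ (2 * k) * [:[:f * fps_nth V k:]:]"
      by (simp only: K.hom_mult mult_ac)
    also have "\<dots> = ([:[:f:]:] * var_Z ^ 2) ^ k * [:[:hasse_deriv_poly k f:]:]"
      unfolding V K.hom_mult K.hom_power power_mult power_mult_distrib by (simp only: mult_ac)
    also have "curve_class f \<dots> = curve_class f (1 * [:[:hasse_deriv_poly k f:]:])"
      by (rule curve_class_cong_mult[OF _ refl]) (metis curve_class_f_Z curve_class_pow power_one)
    finally show "curve_class f (fps_nth (taylor f) k) = curve_class f (fps_nth (Q ^ 2) k)"
      by simp
  qed
  then have "\<Phi> var_Y ^ 2 - taylor f + (taylor f - Q ^ 2) \<in> curve_fps_ideal f"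
    by (rule curve_fps_ideal_add[OF lift_Y_square])
  then have "(\<Phi> var_Y + Q) * (\<Phi> var_Y - Q) \<in> curve_fps_ideal f"
    by (simp add: power2_eq_square algebra_simps)
  moreover obtain c :: "'a poly poly poly" where c: "2 * c = 1"
    using half_exists[OF two] by blast
  have "var_Z * c * fps_nth (\<Phi> var_Y + Q) 0 - 1 = var_Y * var_Z * (2 * c) - 1"
    by (simp add: nth0 Q_def P0 algebra_simps flip: one_pCons)
  then have "var_Z * c * fps_nth (\<Phi> var_Y + Q) 0 - 1 \<in> curve_ideal f"
    by (simp only: c mult_1_right curve_ideal_generators)
  ultimately have "\<Phi> var_Y - Q \<in> curve_fps_ideal f"
    by (rule curve_fps_ideal_cancel[rotated])
  then show thesis
    by (intro that[of P]) (simp add: diff_in_curve_fps_ideal_iff Q_def)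
qed

end

text \<open>For every permutation the exponents \<open>N + \<pi> i - i\<close> add up to
  \<open>N * n\<close>, so all Leibniz terms share one factor. The bound \<open>n \<le> N\<close>
  keeps the subtraction from truncating.\<close>

lemma det_shifted_powers:
  fixes v w :: "'b::comm_ring_1"
  assumes "n \<le> N"
  shows "det (mat n n (\<lambda>(i, j). v * w ^ (N + j - i) * p i j)) =
    (v * w ^ N) ^ n * det (mat n n (\<lambda>(i, j). p i j))"
proof -
  have "(\<Prod>i = 0..<n. v * w ^ (N + \<pi> i - i) * p i (\<pi> i)) =
      (v * w ^ N) ^ n * (\<Prod>i = 0..<n. p i (\<pi> i))" if \<pi>: "\<pi> permutes {0..<n}" for \<pi>
  proof -
    have "(\<Sum>i = 0..<n. N + \<pi> i - i) + (\<Sum>i = 0..<n. i) = (\<Sum>i = 0..<n. N + \<pi> i)"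
      unfolding sum.distrib[symmetric] using assms by (intro sum.cong) auto
    also have "\<dots> = N * n + (\<Sum>i = 0..<n. i)"
      using sum.permute[OF \<pi>, of "\<lambda>i. i"] by (simp add: sum.distrib)
    finally have "(\<Sum>i = 0..<n. N + \<pi> i - i) = N * n" by simp
    then show ?thesis
      by (simp add: prod.distrib power_mult_distrib power_mult flip: power_sum)
  qed
  then show ?thesis
    unfolding det_mat_Leibniz sum_distrib_left
    by (intro sum.cong) (simp_all add: mult.left_commute)
qed

lemma hasse_deriv_poly_monom:
  "hasse_deriv_poly k (monom 1 i :: 'a::field poly) = monom (of_nat (i choose k)) (i - k)"
proof (cases "k \<le> i")
  case True
  have "hasse_deriv_poly k (monom 1 i :: 'a poly) =
      (\<Sum>j\<in>{i}. monom (of_nat (j choose k) * coeff (monom 1 i) j) (j - k))"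
    unfolding hasse_deriv_poly_def
    by (rule sum.mono_neutral_right) (use True in \<open>auto simp: degree_monom_eq\<close>)
  then show ?thesis by simp
next
  case False
  then show ?thesis by (simp add: hasse_deriv_poly_def degree_monom_eq binomial_eq_0)
qed

section \<open>The determinant of the Hasse derivatives of x^i y\<close>

context hasse_lift
begin

text \<open>The Leibniz rule, cut off where the derivatives of x^i vanish. The range
  \<open>{0..<n}\<close> is the same for all rows and columns, so the sum is an entry of a product
  of square matrices.\<close>

lemma lift_power_Y:
  assumes "i < n" "n \<le> k"
  shows "fps_nth (\<Phi> ([:[:monom 1 i:]:] * var_Y)) k =
    (\<Sum>a = 0..<n. [:[:hasse_deriv_poly a (monom 1 i):]:] * fps_nth (\<Phi> var_Y) (k - a))"
proof -
  have "fps_nth (\<Phi> ([:[:monom 1 i:]:] * var_Y)) k =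
      (\<Sum>a = 0..k. [:[:hasse_deriv_poly a (monom 1 i):]:] * fps_nth (\<Phi> var_Y) (k - a))"
    by (simp only: hom_mult const fps_mult_nth taylor_nth)
  also have "\<dots> = (\<Sum>a = 0..<n. [:[:hasse_deriv_poly a (monom 1 i):]:] * fps_nth (\<Phi> var_Y) (k - a))"
    by (rule sum.mono_neutral_right)
      (use assms in \<open>auto simp: hasse_deriv_poly_monom binomial_eq_0\<close>)
  finally show ?thesis .
qed

text \<open>The left factor \<open>?L\<close> has entries (i choose a) x^(i-a): it is lower
  triangular with ones on the diagonal, so it has determinant 1.\<close>

lemma det_lift_power_Y:
  assumes "n \<le> N"
  shows "det (mat n n (\<lambda>(i, j). fps_nth (\<Phi> ([:[:monom 1 i:]:] * var_Y)) (N + j))) =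
    det (mat n n (\<lambda>(i, j). fps_nth (\<Phi> var_Y) (N + j - i)))"
proof -
  let ?L = "mat n n (\<lambda>(i, a). [:[:hasse_deriv_poly a (monom 1 i):]:]) :: 'a poly poly poly mat"
  let ?M = "mat n n (\<lambda>(i, j). fps_nth (\<Phi> var_Y) (N + j - i))"
  have "mat n n (\<lambda>(i, j). fps_nth (\<Phi> ([:[:monom 1 i:]:] * var_Y)) (N + j)) = ?L * ?M"
    by (rule eq_matI)
      (use assms in \<open>auto simp: scalar_prod_def lift_power_Y[where n = n] simp del: mult_pCons_left\<close>)
  moreover have "det (?L * ?M) = det ?L * det ?M"
    by (rule det_mult[of _ n]) auto
  moreover have "det ?L = prod_list (diag_mat ?L)"
    by (rule det_lower_triangular[of n]) (auto simp: hasse_deriv_poly_monom binomial_eq_0)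
  moreover have "diag_mat ?L = replicate n 1"
    by (rule nth_equalityI)
      (simp_all add: diag_mat_def hasse_deriv_poly_monom monom_0 flip: one_pCons)
  ultimately show ?thesis by simp
qed

text \<open>The determinant over the curve is a unit times a determinant over F[x]. Cancelling the
  unit and using that F[x] embeds in R gives the uniqueness behind the definite description. As
  \<open>g\<close> is free here, the atomic polynomials are covered too.\<close>

lemma hasse_inflection_eq_det:
  assumes f: "f \<noteq> 0"
    and P: "\<And>k. curve_class f (fps_nth (\<Phi> var_Y) k) =
       curve_class f (var_Y * var_Z ^ (2 * k) * [:[:fps_nth P k:]:])"
  shows "hasse_inflection f g l =
    det (mat (l - g) (l - g) (\<lambda>(i, j). fps_nth P (l + 1 + j - i)))" (is "_ = ?d")
proof -
  interpret R: cring "curve_ring f" by (rule cring_curve_ring)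
  interpret K: comm_ring_hom "\<lambda>p :: 'a poly. [:[:p:]:]" by (rule const_poly_hom)
  define n where "n = l - g"
  \<comment> \<open>A representative of the normalising factor (f^(-(l+1)) y)^n.\<close>
  define u :: "'a poly poly poly" where "u = (var_Y * (var_Z ^ 2) ^ (l + 1)) ^ n"
  have "ring_det (curve_ring f) n
      (\<lambda>i j. hasse_deriv f (l + 1 + j) (curve_of_poly f (monom 1 i) \<otimes>\<^bsub>curve_ring f\<^esub> curve_y f)) =
      curve_class f (det (mat n n (\<lambda>(i, j). fps_nth (\<Phi> ([:[:monom 1 i:]:] * var_Y)) (l + 1 + j))))"
    unfolding curve_of_poly_class curve_y_class curve_class_mult hasse_deriv_class
    by (rule curve_class_det)
  also have "\<dots> = curve_class f (det (mat n n (\<lambda>(i, j). fps_nth (\<Phi> var_Y) (l + 1 + j - i))))"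
    by (subst det_lift_power_Y) (simp_all add: n_def)
  \<comment> \<open>The hypothesis \<open>P\<close> is an identity of classes only, so the entries
    are exchanged inside \<open>ring_det\<close> before returning to representatives.\<close>
  also have "\<dots> = ring_det (curve_ring f) n (\<lambda>i j. curve_class f
      (var_Y * (var_Z ^ 2) ^ (l + 1 + j - i) * [:[:fps_nth P (l + 1 + j - i):]:]))"
    unfolding curve_class_det[symmetric] P power_mult ..
  also have "\<dots> = curve_class f (u * det (mat n n (\<lambda>(i, j). [:[:fps_nth P (l + 1 + j - i):]:])))"
    unfolding curve_class_det u_def by (subst det_shifted_powers) (simp_all add: n_def)
  also have "det (mat n n (\<lambda>(i, j). [:[:fps_nth P (l + 1 + j - i):]:])) = [:[:?d:]:]"
    unfolding n_def K.hom_det[symmetric] by (rule arg_cong[where f = det]) (auto intro!: eq_matI)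
  finally have lhs: "ring_det (curve_ring f) n
      (\<lambda>i j. hasse_deriv f (l + 1 + j) (curve_of_poly f (monom 1 i) \<otimes>\<^bsub>curve_ring f\<^esub> curve_y f)) =
      curve_class f (u * [:[:?d:]:])" .
  have "inv\<^bsub>curve_ring f\<^esub> (curve_class f [:[:f:]:]) = curve_class f (var_Z ^ 2)"
    by (rule R.comm_inv_char)
      (simp_all only: curve_class_closed curve_class_mult curve_class_f_Z curve_class_one)
  then have rhs: "((inv\<^bsub>curve_ring f\<^esub> (curve_of_poly f f) [^]\<^bsub>curve_ring f\<^esub> (l + 1)) \<otimes>\<^bsub>curve_ring f\<^esub> curve_y f)
      [^]\<^bsub>curve_ring f\<^esub> n \<otimes>\<^bsub>curve_ring f\<^esub> curve_of_poly f p = curve_class f (u * [:[:p:]:])" for p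
    by (simp only: curve_of_poly_class curve_y_class curve_class_mult curve_class_pow u_def mult.commute)
  have "p = q" if "curve_class f (u * [:[:p:]:]) = curve_class f (u * [:[:q:]:])" for p q
  proof -
    \<comment> \<open>The inverse of \<open>u\<close> modulo the ideal, obtained by swapping y and
      z.\<close>
    define w :: "'a poly poly poly" where "w = (var_Z * (var_Y ^ 2) ^ (l + 1)) ^ n"
    have "w * u = ((var_Y * var_Z) * (var_Y * var_Z) ^ (2 * (l + 1))) ^ n"
      unfolding w_def u_def power_mult_distrib power_mult by (simp only: mult_ac)
    also have "\<dots> = (var_Y * var_Z) ^ (Suc (2 * (l + 1)) * n)"
      by (simp only: power_Suc power_mult)
    finally have "curve_class f (w * u) = curve_class f 1"
      by (simp only: curve_class_Y_Z_power)
    then have wu: "curve_class f (w * u * r) = curve_class f (1 * r)" for r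
      by (rule curve_class_cong_mult[OF _ refl])
    have "curve_class f (w * (u * [:[:p:]:])) = curve_class f (w * (u * [:[:q:]:]))"
      by (rule curve_class_cong_mult[OF refl that])
    then have "curve_class f [:[:p:]:] = curve_class f [:[:q:]:]"
      by (simp only: wu mult_1_left flip: mult.assoc)
    then show "p = q" by (rule curve_class_of_poly_inj[OF f])
  qed
  then show ?thesis
    unfolding hasse_inflection_def Let_def lhs[unfolded n_def] rhs[unfolded n_def]
    by (intro the_equality) auto
qed

end

theorem proposition3p12:
  fixes f :: "'a::field poly" and g l \<mu> :: nat
  assumes "CHAR('a) \<noteq> 2"
    and "hyperelliptic_equation g f"
    and "0 < g" and "g < l"
    and "\<mu> = l - g"
  shows "thomogeneous \<mu> (Q_poly \<mu>)
    \<and> tvars (Q_poly \<mu>) \<subseteq> {- int \<mu>..int \<mu> - 1}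
    \<and> hasse_inflection f g l =
      tsubst (\<lambda>i. hasse_inflection f (nat (int l - 1 + i)) (nat (int l + i))) (Q_poly \<mu>)"
proof (intro conjI thomogeneous_Q_poly tvars_Q_poly)
  have "(2 :: 'a) \<noteq> 0"
  proof
    assume "(2 :: 'a) = 0"
    then have "CHAR('a) dvd 2"
      using of_nat_eq_0_iff_char_dvd[where 'a = 'a, of 2] by simp
    then show False
      using assms(1) CHAR_not_1[where 'a = 'a] two_is_prime_nat prime_nat_iff[of 2] by auto
  qed
  then obtain \<Phi> where "hasse_lift \<Phi> f"
    using hasse_lift_exists by blast
  then interpret hasse_lift \<Phi> f .
  have f: "f \<noteq> 0"
    using assms(2) by (auto simp: hyperelliptic_equation_def)
  obtain P where P: "curve_class f (fps_nth (\<Phi> var_Y) k) =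
      curve_class f (var_Y * var_Z ^ (2 * k) * [:[:fps_nth P k:]:])" for k
    by (rule lift_Y) blast
  \<comment> \<open>A 1 by 1 determinant, whose only entry has index (m + 1) + 1.\<close>
  have atomic: "hasse_inflection f m (Suc m) = fps_nth P (m + 2)" for m
    by (subst hasse_inflection_eq_det[OF f P]) (simp_all add: det_single)
  have entry: "hasse_inflection f (nat (int l - 1 + (int j - int i))) (nat (int l + (int j - int i))) =
      fps_nth P (l + 1 + j - i)" if "i < \<mu>" for i j
  proof -
    define m where "m = l - 1 + j - i"
    \<comment> \<open>Hence l - 1 + j - i is nonnegative, and neither \<open>nat\<close> nor natural
      subtraction truncates.\<close>
    have "i < l" using that assms by simp
    then have "nat (int l - 1 + (int j - int i)) = m" "nat (int l + (int j - int i)) = Suc m"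
      "l + 1 + j - i = m + 2"
      by (auto simp: m_def)
    then show ?thesis by (simp only: atomic)
  qed
  have "hasse_inflection f g l = det (mat \<mu> \<mu> (\<lambda>(i, j). fps_nth P (l + 1 + j - i)))"
    unfolding assms(5) by (rule hasse_inflection_eq_det[OF f P])
  also have "mat \<mu> \<mu> (\<lambda>(i, j). fps_nth P (l + 1 + j - i)) = mat \<mu> \<mu> (\<lambda>(i, j).
      hasse_inflection f (nat (int l - 1 + (int j - int i))) (nat (int l + (int j - int i))))"
    by (rule eq_matI) (simp_all add: entry)
  finally show "hasse_inflection f g l =
      tsubst (\<lambda>i. hasse_inflection f (nat (int l - 1 + i)) (nat (int l + i))) (Q_poly \<mu>)"
    by (simp only: tsubst_Q_poly)
qed

end
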